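(* For every finite graph $G$ there is a graph $H$ which is $C^2$-equivalent to $G$ and which is multi-circulant with respect to the coarsest equitable partition of $H$.
   Context: Graphs are finite, undirected, without loops. $C^2$ is the $2$-variable fragment of first-order logic with counting quantifiers $\exists^{\ge t}$; two graphs are $C^2$-equivalent if no $C^2$-sentence distinguishes them. A partition $\Pi$ of $V(H)$ is equitable if for all $P,Q\in\Pi$ all vertices of $P$ have the same number of neighbors in $Q$. A graph is multi-circulant with respect to a partition $\{P_1,\dots,P_\ell\}$ of its vertex set if it has an automorphism whose cycle decomposition (as a permutation, counting fixed points as cycles of length $1$) consists of exactly $\ell$ cycles, the $i$-th cycle being on $P_i$. *)

theory Defs
  imports
    "Graph_Theory.Pair_Digraph"
    "HOL-Combinatorics.Orbits"
    "HOL-Library.Disjoint_Sets"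
begin

text \<open>
  Finite undirected loopless graphs are rendered by the locale \<^locale>\<open>pair_graph\<close>: an edge
  between \<open>u\<close> and \<open>v\<close> is represented by the two arcs \<open>(u, v)\<close> and \<open>(v, u)\<close>.
\<close>

section \<open>Two-variable first-order logic with counting quantifiers\<close>

datatype c2_var = X | Y

text \<open>
  \<open>ExGe t x \<phi>\<close> is the counting quantification over \<open>x\<close> with threshold \<open>t\<close>; the
  ordinary existential quantifier is the case \<open>t = 1\<close>. The other connectives and the universal
  quantifier are definable from the constructors below.
\<close>
datatype c2_fm =
    Adj c2_var c2_var
  | Eq c2_var c2_var
  | Neg c2_fm
  | Conj c2_fm c2_fm
  | ExGe nat c2_var c2_fm

primrec free_vars :: "c2_fm \<Rightarrow> c2_var set" where
  "free_vars (Adj x y) = {x, y}"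
| "free_vars (Eq x y) = {x, y}"
| "free_vars (Neg \<phi>) = free_vars \<phi>"
| "free_vars (Conj \<phi> \<psi>) = free_vars \<phi> \<union> free_vars \<psi>"
| "free_vars (ExGe t x \<phi>) = free_vars \<phi> - {x}"

definition c2_sentence :: "c2_fm \<Rightarrow> bool" where
  "c2_sentence \<phi> \<longleftrightarrow> free_vars \<phi> = {}"

text \<open>The cardinality in the last clause is meaningful because only finite graphs are considered.\<close>
primrec c2_sat :: "'a pair_pre_digraph \<Rightarrow> (c2_var \<Rightarrow> 'a) \<Rightarrow> c2_fm \<Rightarrow> bool" where
  "c2_sat G \<sigma> (Adj x y) \<longleftrightarrow> (\<sigma> x, \<sigma> y) \<in> parcs G"
| "c2_sat G \<sigma> (Eq x y) \<longleftrightarrow> \<sigma> x = \<sigma> y"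
| "c2_sat G \<sigma> (Neg \<phi>) \<longleftrightarrow> \<not> c2_sat G \<sigma> \<phi>"
| "c2_sat G \<sigma> (Conj \<phi> \<psi>) \<longleftrightarrow> c2_sat G \<sigma> \<phi> \<and> c2_sat G \<sigma> \<psi>"
| "c2_sat G \<sigma> (ExGe t x \<phi>) \<longleftrightarrow> t \<le> card {v \<in> pverts G. c2_sat G (\<sigma>(x := v)) \<phi>}"

lemma c2_sat_cong:
  "(\<And>x. x \<in> free_vars \<phi> \<Longrightarrow> \<sigma> x = \<tau> x) \<Longrightarrow> c2_sat G \<sigma> \<phi> \<longleftrightarrow> c2_sat G \<tau> \<phi>"
proof (induction \<phi> arbitrary: \<sigma> \<tau>)
  case (Conj \<phi> \<psi>)
  have "c2_sat G \<sigma> \<phi> \<longleftrightarrow> c2_sat G \<tau> \<phi>"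
    by (rule Conj.IH(1)) (simp add: Conj.prems)
  moreover have "c2_sat G \<sigma> \<psi> \<longleftrightarrow> c2_sat G \<tau> \<psi>"
    by (rule Conj.IH(2)) (simp add: Conj.prems)
  ultimately show ?case by simp
next
  case (ExGe t x \<phi>)
  have "c2_sat G (\<sigma>(x := v)) \<phi> \<longleftrightarrow> c2_sat G (\<tau>(x := v)) \<phi>" for v
    using ExGe.prems by (intro ExGe.IH) auto
  then show ?case by simp
next
  case (Neg \<phi>)
  have "c2_sat G \<sigma> \<phi> \<longleftrightarrow> c2_sat G \<tau> \<phi>"
    by (rule Neg.IH) (simp add: Neg.prems)
  then show ?case by simp
qed simp_all

text \<open>
  Assignments range over the whole vertex type rather than over the vertices of \<open>G\<close>. For sentences
  this makes no difference, except that truth in the graph without vertices is two-valued as well.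
\<close>
definition c2_models :: "'a pair_pre_digraph \<Rightarrow> c2_fm \<Rightarrow> bool" where
  "c2_models G \<phi> \<longleftrightarrow> (\<forall>\<sigma>. c2_sat G \<sigma> \<phi>)"

lemma c2_models_sentence:
  "c2_sentence \<phi> \<Longrightarrow> c2_models G \<phi> \<longleftrightarrow> c2_sat G \<sigma> \<phi>"
proof -
  assume "c2_sentence \<phi>"
  then have "c2_sat G \<tau> \<phi> \<longleftrightarrow> c2_sat G \<sigma> \<phi>" for \<tau>
    by (intro c2_sat_cong) (simp add: c2_sentence_def)
  then show ?thesis
    unfolding c2_models_def by blast
qed

definition c2_equivalent :: "'a pair_pre_digraph \<Rightarrow> 'b pair_pre_digraph \<Rightarrow> bool" where
  "c2_equivalent G H \<longleftrightarrow> (\<forall>\<phi>. c2_sentence \<phi> \<longrightarrow> (c2_models G \<phi> \<longleftrightarrow> c2_models H \<phi>))"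

section \<open>Equitable partitions\<close>

definition equitable :: "'a pair_pre_digraph \<Rightarrow> 'a set set \<Rightarrow> bool" where
  "equitable H \<P> \<longleftrightarrow> partition_on (pverts H) \<P> \<and>
     (\<forall>P\<in>\<P>. \<forall>Q\<in>\<P>. \<forall>u\<in>P. \<forall>v\<in>P.
       card {w \<in> Q. (u, w) \<in> parcs H} = card {w \<in> Q. (v, w) \<in> parcs H})"

definition coarsest_equitable :: "'a pair_pre_digraph \<Rightarrow> 'a set set \<Rightarrow> bool" where
  "coarsest_equitable H \<P> \<longleftrightarrow> equitable H \<P> \<and> (\<forall>\<P>'. equitable H \<P>' \<longrightarrow> refines (pverts H) \<P>' \<P>)"

lemma coarsest_equitable_unique:
  "coarsest_equitable H \<P> \<Longrightarrow> coarsest_equitable H \<P>' \<Longrightarrow> \<P> = \<P>'"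
  unfolding coarsest_equitable_def by (meson refines_asym)

section \<open>Multi-circulant graphs\<close>

definition graph_automorphism :: "'a pair_pre_digraph \<Rightarrow> ('a \<Rightarrow> 'a) \<Rightarrow> bool" where
  "graph_automorphism H f \<longleftrightarrow> f permutes pverts H \<and>
     (\<forall>u\<in>pverts H. \<forall>v\<in>pverts H. (f u, f v) \<in> parcs H \<longleftrightarrow> (u, v) \<in> parcs H)"

text \<open>
  As \<open>\<P>\<close> partitions the vertex set, the condition on \<open>f\<close> says that its cycles, fixed points
  included, are exactly one on each member of \<open>\<P>\<close>.
\<close>
definition multi_circulant :: "'a pair_pre_digraph \<Rightarrow> 'a set set \<Rightarrow> bool" where
  "multi_circulant H \<P> \<longleftrightarrow> partition_on (pverts H) \<P> \<and>
     (\<exists>f. graph_automorphism H f \<and> (\<forall>P\<in>\<P>. cyclic_on f P))"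

end

(*
  Let n i be the sizes of the cells of the coarsest equitable partition of G, and let d i j be the
  number of neighbours in cell j of a vertex in cell i. Any graph with an equitable partition with
  the same parameters n and d is C^2-equivalent to G, and this partition is then its coarsest one.
  Take copies of the cyclic groups of order n i as cells of H, and let adjacency between cells i
  and j depend only on the difference of the positions modulo g = gcd (n i) (n j). Each residue
  contributes n j / g neighbours, and double counting, n i * d i j = n j * d j i, shows that n j / g
  divides d i j, so the right degrees can be attained; inside a cell, the handshake lemma provides
  the symmetric connection set. Rotating all the cyclic groups simultaneously is an automorphism.
*)
theory Submission
  imports Defs "HOL-Library.Nat_Bijection" "HOL-Library.Multiset"
begin

section \<open>Counting by fibres\<close>

text \<open>Both sides are sums over the common values \<open>c\<close>. Fibres over
  \<open>c\<close> of equal size are both empty or both inhabited; if inhabited, \<open>PQ\<close>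
  forces \<open>P\<close> and \<open>Q\<close> to be constant on them with the same truth value, so
  each summand is either the whole fibre or nothing on both sides.\<close>

lemma card_Collect_eq_if_fibres_eq:
  assumes fin: "finite A" "finite B"
    and fibres: "\<And>c. card {x \<in> A. f x = c} = card {y \<in> B. g y = c}"
    and PQ: "\<And>x y. x \<in> A \<Longrightarrow> y \<in> B \<Longrightarrow> f x = g y \<Longrightarrow> P x \<longleftrightarrow> Q y"
  shows "card {x \<in> A. P x} = card {y \<in> B. Q y}"
proof -
  let ?C = "f ` A \<union> g ` B"
  have split: "card {x \<in> S. R x} = (\<Sum>c\<in>?C. card {x \<in> S. R x \<and> h x = c})"
    if "finite S" "h ` S \<subseteq> ?C" for S and R :: "'d \<Rightarrow> bool" and h
  proof -
    have "card {x \<in> S. R x} = (\<Sum>c\<in>?C. \<Sum>x\<in>{x \<in> {x \<in> S. R x}. h x = c}. 1)"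
      using that fin by (subst sum.group) auto
    then show ?thesis by (simp add: conj_assoc)
  qed
  have "card {x \<in> A. P x \<and> f x = c} = card {y \<in> B. Q y \<and> g y = c}" for c
  proof (cases "{x \<in> A. f x = c} = {}")
    case True
    then have "card {y \<in> B. g y = c} = 0" using fibres[of c] by (simp only: card.empty)
    then have "{y \<in> B. g y = c} = {}" using fin by simp
    then have "{x \<in> A. P x \<and> f x = c} = {}" "{y \<in> B. Q y \<and> g y = c} = {}" using True by blast+
    then show ?thesis by (simp only: card.empty)
  next
    case False
    then obtain a where a: "a \<in> A" "f a = c" by blast
    have "card {y \<in> B. g y = c} \<noteq> 0" using False fin by (simp add: fibres[symmetric])
    then obtain b where b: "b \<in> B" "g b = c" by (metis (mono_tags, lifting) card.empty ex_in_conv mem_Collect_eq)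
    have "P x \<longleftrightarrow> P a" if "x \<in> A" "f x = c" for x using PQ[of x b] PQ[of a b] a b that by simp
    then have "{x \<in> A. P x \<and> f x = c} = (if P a then {x \<in> A. f x = c} else {})" by auto
    moreover have "Q y \<longleftrightarrow> P a" if "y \<in> B" "g y = c" for y using PQ[of a y] a that by simp
    then have "{y \<in> B. Q y \<and> g y = c} = (if P a then {y \<in> B. g y = c} else {})" by auto
    ultimately show ?thesis using fibres[of c] by simp
  qed
  then show ?thesis using split[of A f P] split[of B g Q] fin by simp
qed

text \<open>Handshake argument: an injective numbering \<open>e\<close> of the field orients every
  pair, and swapping maps the increasing pairs bijectively onto the decreasing ones. Irreflexivity
  leaves no other pairs.\<close>

lemma even_card_sym_irrefl:
  fixes R :: "('a \<times> 'a) set"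
  assumes fin: "finite R" and "sym R" and "irrefl R"
  shows "even (card R)"
proof -
  obtain e :: "'a \<Rightarrow> nat" where e: "inj_on e (Field R)"
    using finite_imp_inj_to_nat_seg[OF finite_Field[OF fin]] by metis
  define L where "L = {(u, v) \<in> R. e u < e v}"
  have "R = L \<union> prod.swap ` L"
  proof (intro set_eqI iffI)
    fix p assume "p \<in> R"
    then obtain u v where p: "p = (u, v)" "(u, v) \<in> R" by (cases p) auto
    then have "u \<noteq> v" using \<open>irrefl R\<close> by (auto simp: irrefl_def)
    then have "e u \<noteq> e v" using e p by (auto simp: inj_on_def Field_def)
    moreover have "(v, u) \<in> R" using p \<open>sym R\<close> by (auto simp: sym_def)
    ultimately show "p \<in> L \<union> prod.swap ` L"
      using p by (cases "e u < e v") (auto simp: L_def image_iff)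
  qed (use \<open>sym R\<close> in \<open>auto simp: L_def sym_def\<close>)
  moreover have "L \<inter> prod.swap ` L = {}" by (auto simp: L_def)
  moreover have "finite L" by (rule finite_subset[OF _ fin]) (auto simp: L_def)
  ultimately have "card R = card L + card (prod.swap ` L)"
    by (metis card_Un_disjoint finite_imageI)
  then show ?thesis by (simp add: card_image)
qed

section \<open>Matching colourings\<close>

abbreviation nbrs :: "'a pair_pre_digraph \<Rightarrow> 'a \<Rightarrow> 'a set" where
  "nbrs G u \<equiv> {w. (u, w) \<in> parcs G}"

lemma pair_graphD:
  assumes "pair_graph G"
  shows "finite (pverts G)" "finite (parcs G)"
    "(u, v) \<in> parcs G \<Longrightarrow> u \<in> pverts G" "(u, v) \<in> parcs G \<Longrightarrow> v \<in> pverts G"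
    "(u, v) \<in> parcs G \<Longrightarrow> (v, u) \<in> parcs G" "(u, u) \<notin> parcs G" "finite (nbrs G u)"
proof -
  interpret pair_graph G by fact
  show V: "finite (pverts G)" "finite (parcs G)"
    by (fact pair_finite_verts, fact pair_finite_arcs)
  show snd: "(u, v) \<in> parcs G \<Longrightarrow> v \<in> pverts G" for u v
    using arc_snd_in_verts by force
  show "(u, v) \<in> parcs G \<Longrightarrow> u \<in> pverts G" using arc_fst_in_verts by force
  show "(u, v) \<in> parcs G \<Longrightarrow> (v, u) \<in> parcs G"
    using pair_sym_arcs by (auto simp: symmetric_def sym_def)
  show "(u, u) \<notin> parcs G" using pair_no_loops by force
  show "finite (nbrs G u)" using V by (rule_tac finite_subset[of _ "pverts G"]) (auto dest: snd)
qed

text \<open>Equitability phrased for colourings, so that it can also relate two different graphs.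
  For \<open>G = H\<close> and \<open>f = g\<close> it makes the colour classes an equitable
  partition of a \<open>pair_graph\<close>.\<close>

definition matching ::
  "'a pair_pre_digraph \<Rightarrow> ('a \<Rightarrow> 'c) \<Rightarrow> 'b pair_pre_digraph \<Rightarrow> ('b \<Rightarrow> 'c) \<Rightarrow> bool" where
  "matching G f H g \<longleftrightarrow> (\<forall>u\<in>pverts G. \<forall>v\<in>pverts H. f u = g v \<longrightarrow>
     (\<forall>c. card {w \<in> nbrs G u. f w = c} = card {w \<in> nbrs H v. g w = c}))"

text \<open>Assignments still take values in the vertex type when there are no vertices, so this
  case is treated on its own. Adjacency is false, every count is 0, and the only remaining
  information is whether the two variables have equal values.\<close>

lemma c2_sat_empty:
  assumes "pverts G = {}" "parcs G = {}" "pverts H = {}" "parcs H = {}"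
    and "\<sigma> X = \<sigma> Y \<longleftrightarrow> \<tau> X = \<tau> Y"
  shows "c2_sat G \<sigma> \<phi> \<longleftrightarrow> c2_sat H \<tau> \<phi>"
  using assms(5)
proof (induction \<phi> arbitrary: \<sigma> \<tau>)
  case (Eq x y)
  then show ?case by (cases x; cases y) auto
qed (use assms(1-4) in auto)

text \<open>
  Duplicator's strategy in the bijective 2-pebble game: with the pebble of the variable \<open>y\<close> fixed,
  the vertices are classified by their colour, equality with \<open>\<sigma> y\<close> and adjacency to \<open>\<sigma> y\<close>, and
  these classes have the same sizes in both graphs.
\<close>
lemma c2_sat_matching:
  assumes G: "pair_graph G" and H: "pair_graph H" and "matching G f H g"
    and sizes: "\<And>c. card {u \<in> pverts G. f u = c} = card {v \<in> pverts H. g v = c}"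
    and "\<And>x. \<sigma> x \<in> pverts G" "\<And>x. \<tau> x \<in> pverts H" "\<And>x. f (\<sigma> x) = g (\<tau> x)"
    and "\<And>x y. \<sigma> x = \<sigma> y \<longleftrightarrow> \<tau> x = \<tau> y"
    and "\<And>x y. (\<sigma> x, \<sigma> y) \<in> parcs G \<longleftrightarrow> (\<tau> x, \<tau> y) \<in> parcs H"
  shows "c2_sat G \<sigma> \<phi> \<longleftrightarrow> c2_sat H \<tau> \<phi>"
  using assms(5-)
proof (induction \<phi> arbitrary: \<sigma> \<tau>)
  case (ExGe t x \<phi>)
  define y where "y = (if x = X then Y else X)"
  have y: "y \<noteq> x" "\<And>z. z = x \<or> z = y" unfolding y_def by (metis c2_var.exhaust c2_var.distinct(1))+
  let ?f = "\<lambda>v. (f v, v = \<sigma> y, (\<sigma> y, v) \<in> parcs G)"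
  let ?g = "\<lambda>v. (g v, v = \<tau> y, (\<tau> y, v) \<in> parcs H)"
  have nb: "card {w \<in> nbrs G (\<sigma> y). f w = c} = card {w \<in> nbrs H (\<tau> y). g w = c}" for c
    using \<open>matching G f H g\<close> ExGe.prems unfolding matching_def by blast
  have fibre: "card {v \<in> pverts G. ?f v = k} = card {v \<in> pverts H. ?g v = k}" for k
  proof -
    obtain c e a where k: "k = (c, e, a)" by (cases k)
    have arcs: "{v \<in> pverts G. f v = c \<and> v \<noteq> \<sigma> y \<and> (\<sigma> y, v) \<in> parcs G} = {w \<in> nbrs G (\<sigma> y). f w = c}"
      "{v \<in> pverts H. g v = c \<and> v \<noteq> \<tau> y \<and> (\<tau> y, v) \<in> parcs H} = {w \<in> nbrs H (\<tau> y). g w = c}"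
      using pair_graphD[OF G] pair_graphD[OF H] by blast+
    have self: "{v \<in> pverts G. f v = c \<and> v = \<sigma> y} = (if f (\<sigma> y) = c then {\<sigma> y} else {})"
      "{v \<in> pverts H. g v = c \<and> v = \<tau> y} = (if g (\<tau> y) = c then {\<tau> y} else {})"
      using ExGe.prems by auto
    show ?thesis
    proof (cases e)
      case True
      \<comment> \<open>Without loops, a vertex equal to the pebbled one is never adjacent to
        it.\<close>
      have "{v \<in> pverts G. ?f v = k} = (if a then {} else {v \<in> pverts G. f v = c \<and> v = \<sigma> y})"
        "{v \<in> pverts H. ?g v = k} = (if a then {} else {v \<in> pverts H. g v = c \<and> v = \<tau> y})"
        using True k pair_graphD(6)[OF G] pair_graphD(6)[OF H] by auto
      then show ?thesis using self ExGe.prems(3) by simp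
    next
      case False
      show ?thesis
      proof (cases a)
        case True
        with False arcs nb[of c] show ?thesis by (simp add: k)
      next
        case na: False
        \<comment> \<open>The vertices of colour \<open>c\<close> neither equal nor adjacent to the
          pebbled one are the complement of the two other kinds within the colour class, so their
          number follows by subtraction.\<close>
        have "{v \<in> pverts G. ?f v = k} = {u \<in> pverts G. f u = c} -
             ({v \<in> pverts G. f v = c \<and> v = \<sigma> y} \<union> {w \<in> nbrs G (\<sigma> y). f w = c})"
          "{v \<in> pverts H. ?g v = k} = {u \<in> pverts H. g u = c} -
             ({v \<in> pverts H. g v = c \<and> v = \<tau> y} \<union> {w \<in> nbrs H (\<tau> y). g w = c})"
          using False na k by auto
        moreover have "card ({v \<in> pverts G. f v = c \<and> v = \<sigma> y} \<union> {w \<in> nbrs G (\<sigma> y). f w = c})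
           = card ({v \<in> pverts H. g v = c \<and> v = \<tau> y} \<union> {w \<in> nbrs H (\<tau> y). g w = c})"
          unfolding self using nb[of c] ExGe.prems(3)[of y] pair_graphD(6,7)[OF G] pair_graphD(6,7)[OF H]
          by auto
        moreover have "finite ({v \<in> pverts G. f v = c \<and> v = \<sigma> y} \<union> {w \<in> nbrs G (\<sigma> y). f w = c})"
          "finite ({v \<in> pverts H. g v = c \<and> v = \<tau> y} \<union> {w \<in> nbrs H (\<tau> y). g w = c})"
          using pair_graphD(1,7)[OF G] pair_graphD(1,7)[OF H] by simp_all
        moreover have "{v \<in> pverts G. f v = c \<and> v = \<sigma> y} \<union> {w \<in> nbrs G (\<sigma> y). f w = c} \<subseteq> {u \<in> pverts G. f u = c}"
          "{v \<in> pverts H. g v = c \<and> v = \<tau> y} \<union> {w \<in> nbrs H (\<tau> y). g w = c} \<subseteq> {u \<in> pverts H. g u = c}"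
          using pair_graphD(4)[OF G] pair_graphD(4)[OF H] by blast+
        ultimately show ?thesis using sizes[of c] by (simp only: card_Diff_subset)
      qed
    qed
  qed
  have "card {v \<in> pverts G. c2_sat G (\<sigma>(x := v)) \<phi>} = card {v \<in> pverts H. c2_sat H (\<tau>(x := v)) \<phi>}"
  proof (rule card_Collect_eq_if_fibres_eq[OF pair_graphD(1)[OF G] pair_graphD(1)[OF H] fibre])
    fix v w assume vw: "v \<in> pverts G" "w \<in> pverts H" "?f v = ?g w"
    \<comment> \<open>\<open>?f\<close> and \<open>?g\<close> record only arcs leaving the pebbled
      vertex; the opposite direction comes from symmetry.\<close>
    have s: "(v, \<sigma> y) \<in> parcs G \<longleftrightarrow> (w, \<tau> y) \<in> parcs H"
      using vw pair_graphD(5)[OF G] pair_graphD(5)[OF H] by blast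
    show "c2_sat G (\<sigma>(x := v)) \<phi> \<longleftrightarrow> c2_sat H (\<tau>(x := w)) \<phi>"
    proof (rule ExGe.IH)
      fix z z'
      show "(\<sigma>(x := v)) z = (\<sigma>(x := v)) z' \<longleftrightarrow> (\<tau>(x := w)) z = (\<tau>(x := w)) z'"
        using vw y(1) y(2)[of z] y(2)[of z'] by auto
      show "((\<sigma>(x := v)) z, (\<sigma>(x := v)) z') \<in> parcs G \<longleftrightarrow> ((\<tau>(x := w)) z, (\<tau>(x := w)) z') \<in> parcs H"
        using vw s y(1) y(2)[of z] y(2)[of z'] pair_graphD(6)[OF G] pair_graphD(6)[OF H] by auto
    qed (use vw ExGe.prems in auto)
  qed
  then show ?case by simp
next
  case (Neg \<phi>)
  show ?case using Neg.IH[OF Neg.prems] by simp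
next
  case (Conj \<phi> \<psi>)
  show ?case using Conj.IH(1)[OF Conj.prems] Conj.IH(2)[OF Conj.prems] by simp
next
  case (Adj x y)
  show ?case unfolding c2_sat.simps by (rule Adj.prems(5))
next
  case (Eq x y)
  show ?case unfolding c2_sat.simps by (rule Eq.prems(4))
qed

text \<open>The truth of a sentence can be tested at one assignment per graph. Equal class sizes
  supply equally coloured vertices \<open>u\<close> and \<open>v\<close> unless both graphs are
  empty, and the constant assignments at \<open>u\<close> and \<open>v\<close> are a valid starting
  position because neither graph has loops.\<close>

lemma c2_equivalent_matching:
  assumes G: "pair_graph G" and H: "pair_graph H" and m: "matching G f H g"
    and sizes: "\<And>c. card {u \<in> pverts G. f u = c} = card {v \<in> pverts H. g v = c}"
  shows "c2_equivalent G H"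
  unfolding c2_equivalent_def
proof (intro allI impI)
  fix \<phi> assume s: "c2_sentence \<phi>"
  have fin: "finite {u \<in> pverts G. P u}" "finite {v \<in> pverts H. Q v}" for P Q
    using pair_graphD(1)[OF G] pair_graphD(1)[OF H] by auto
  have "\<exists>\<sigma> \<tau>. c2_sat G \<sigma> \<phi> \<longleftrightarrow> c2_sat H \<tau> \<phi>"
  proof (cases "pverts G = {}")
    case True
    have "v \<notin> pverts H" for v
    proof
      assume "v \<in> pverts H"
      then have "card {w \<in> pverts H. g w = g v} > 0" using fin by (auto simp: card_gt_0_iff)
      then show False using sizes[of "g v"] True by simp
    qed
    then have "c2_sat G (\<lambda>_. undefined) \<phi> \<longleftrightarrow> c2_sat H (\<lambda>_. undefined) \<phi>"
      using True pair_graphD(3)[OF G] pair_graphD(3)[OF H] by (intro c2_sat_empty) auto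
    then show ?thesis by blast
  next
    case False
    then obtain u where u: "u \<in> pverts G" by auto
    then have "card {w \<in> pverts G. f w = f u} > 0" using fin by (auto simp: card_gt_0_iff)
    then have "{v \<in> pverts H. g v = f u} \<noteq> {}" using sizes[of "f u"] by (metis card.empty less_irrefl)
    then obtain v where v: "v \<in> pverts H" "f u = g v" by auto
    have "c2_sat G (\<lambda>_. u) \<phi> \<longleftrightarrow> c2_sat H (\<lambda>_. v) \<phi>"
      using u v pair_graphD(6)[OF G] pair_graphD(6)[OF H]
      by (intro c2_sat_matching[OF G H m sizes]) auto
    then show ?thesis by blast
  qed
  then show "c2_models G \<phi> \<longleftrightarrow> c2_models H \<phi>" by (metis c2_models_sentence[OF s])
qed

section \<open>Colour refinement\<close>

text \<open>The type of colours does not depend on the graph, so colours can be compared across graphs.\<close>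
datatype colour = Base | Refine colour "colour multiset"

primrec refinement :: "'a pair_pre_digraph \<Rightarrow> nat \<Rightarrow> 'a \<Rightarrow> colour" where
  "refinement G 0 v = Base"
| "refinement G (Suc k) v =
     Refine (refinement G k v) (image_mset (refinement G k) (mset_set (nbrs G v)))"

lemma count_image_mset_set:
  assumes "finite A"
  shows "count (image_mset f (mset_set A)) c = card {x \<in> A. f x = c}"
proof -
  have "count (image_mset f (mset_set A)) c = (\<Sum>x\<in>{x \<in> A. c = f x}. count (mset_set A) x)"
    using assms by (simp only: count_image_mset' elem_mset_set)
  also have "\<dots> = (\<Sum>x\<in>{x \<in> A. f x = c}. 1)"
    using assms by (intro sum.cong) auto
  finally show ?thesis by simp
qed

text \<open>Matching colourings are at least as fine as every round of colour refinement. In the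
  induction step, neighbours of equal colour have equal refinement colours, so equal numbers of
  neighbours in each class yield equal multisets.\<close>

lemma refinement_matching:
  assumes G: "pair_graph G" and H: "pair_graph H" and m: "matching G f H g"
    and "u \<in> pverts G" "v \<in> pverts H" "f u = g v"
  shows "refinement G k u = refinement H k v"
  using assms(4-)
proof (induction k arbitrary: u v)
  case 0
  show ?case by simp
next
  case (Suc k)
  have "card {w \<in> nbrs G u. refinement G k w = c} = card {w \<in> nbrs H v. refinement H k w = c}" for c
  proof (rule card_Collect_eq_if_fibres_eq[where f = f and g = g])
    show "card {w \<in> nbrs G u. f w = c} = card {w \<in> nbrs H v. g w = c}" for c
      using m Suc.prems unfolding matching_def by blast
  next
    fix w w' assume "w \<in> nbrs G u" "w' \<in> nbrs H v" "f w = g w'"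
    then have "refinement G k w = refinement H k w'"
      using pair_graphD(4)[OF G] pair_graphD(4)[OF H] by (intro Suc.IH) auto
    then show "refinement G k w = c \<longleftrightarrow> refinement H k w' = c" by simp
  qed (simp_all add: pair_graphD(7) G H)
  then show ?case
    using Suc by (auto simp: multiset_eq_iff count_image_mset_set pair_graphD(7) G H)
qed

text \<open>Each \<open>Refine\<close> colour contains the colour of the preceding round, so
  equality propagates downwards.\<close>

lemma refinement_antimono:
  assumes "refinement G k u = refinement H k v" "j \<le> k"
  shows "refinement G j u = refinement H j v"
  using assms(2)
proof (induction rule: inc_induct)
  case base
  show ?case by (fact assms(1))
next
  case (step j)
  from step.IH show ?case unfolding refinement.simps by (simp only: colour.inject)
qed

text \<open>A pair of vertices separated in some round stays separated in all later ones. As there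
  are only finitely many pairs, a single round \<open>K\<close> separates all that are ever
  separated.\<close>

lemma refinement_stable:
  assumes G: "pair_graph G"
  obtains K where "\<And>u v k. u \<in> pverts G \<Longrightarrow> v \<in> pverts G \<Longrightarrow> refinement G K u = refinement G K v
     \<Longrightarrow> refinement G k u = refinement G k v"
proof -
  have "\<forall>\<^sub>F K in sequentially. refinement G K (fst p) = refinement G K (snd p) \<longrightarrow>
      (\<forall>k. refinement G k (fst p) = refinement G k (snd p))" for p
  proof (cases "\<forall>k. refinement G k (fst p) = refinement G k (snd p)")
    case False
    then obtain k where "refinement G k (fst p) \<noteq> refinement G k (snd p)" by auto
    then show ?thesis
      unfolding eventually_sequentially by (metis refinement_antimono)
  qed simp
  then have "\<forall>\<^sub>F K in sequentially. \<forall>p\<in>pverts G \<times> pverts G.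
      refinement G K (fst p) = refinement G K (snd p) \<longrightarrow>
      (\<forall>k. refinement G k (fst p) = refinement G k (snd p))"
    using pair_graphD(1)[OF G] by (intro eventually_ball_finite) auto
  from eventually_happens'[OF sequentially_bot this]
  obtain K where "\<forall>p\<in>pverts G \<times> pverts G.
      refinement G K (fst p) = refinement G K (snd p) \<longrightarrow>
      (\<forall>k. refinement G k (fst p) = refinement G k (snd p))"
    by (elim exE)
  then have "refinement G k u = refinement G k v"
    if "u \<in> pverts G" "v \<in> pverts G" "refinement G K u = refinement G K v" for u v k
    using that by (metis SigmaI fst_conv snd_conv)
  then show thesis using that by blast
qed

text \<open>Renumbers the colours of a stable round by an initial segment of the naturals, so that
  they can index the cells of the graph to be built. The last property says that this colouring is
  no finer than colour refinement.\<close>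

lemma stable_colouring:
  assumes G: "pair_graph G"
  obtains f :: "'a \<Rightarrow> nat" and m where "f ` pverts G = {..<m}" "matching G f G f"
    "\<And>u v. u \<in> pverts G \<Longrightarrow> v \<in> pverts G \<Longrightarrow> (\<And>k. refinement G k u = refinement G k v) \<Longrightarrow> f u = f v"
proof -
  obtain K where K: "\<And>u v k. u \<in> pverts G \<Longrightarrow> v \<in> pverts G \<Longrightarrow>
      refinement G K u = refinement G K v \<Longrightarrow> refinement G k u = refinement G k v"
    using refinement_stable[OF G] by blast
  let ?C = "refinement G K ` pverts G"
  obtain h where h: "bij_betw h ?C {0..<card ?C}"
    using ex_bij_betw_finite_nat[of ?C] pair_graphD(1)[OF G] by blast
  define f where "f u = h (refinement G K u)" for u
  have f: "f u = f v \<longleftrightarrow> refinement G K u = refinement G K v" if "u \<in> pverts G" "v \<in> pverts G" for u v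
    using h that unfolding f_def bij_betw_def by (intro inj_on_eq_iff[of h ?C]) auto
  have img: "f ` pverts G = {..<card ?C}"
    using h by (auto simp: bij_betw_def f_def image_image)
  have "card {w \<in> nbrs G u. f w = c} = card {w \<in> nbrs G v. f w = c}"
    if uv: "u \<in> pverts G" "v \<in> pverts G" "f u = f v" for u v c
  proof (rule card_Collect_eq_if_fibres_eq[where f = "refinement G K" and g = "refinement G K"])
    \<comment> \<open>Stability is used one round further on, where the colour exposes the multiset
      of the neighbours' colours in round \<open>K\<close>.\<close>
    have "refinement G (Suc K) u = refinement G (Suc K) v" using K f uv by blast
    then show "card {w \<in> nbrs G u. refinement G K w = c} = card {w \<in> nbrs G v. refinement G K w = c}" for c
      by (simp add: multiset_eq_iff count_image_mset_set pair_graphD(7) G)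
  qed (simp_all add: f_def pair_graphD(7) G)
  then have "matching G f G f" unfolding matching_def by blast
  then show thesis using that[of f "card ?C"] f img by blast
qed

section \<open>Equitable partitions as colourings, and the coarsest one\<close>

text \<open>Each vertex is coloured by the cell that contains it; values that are not cells have
  empty fibres.\<close>

lemma cell_colouring:
  assumes "equitable H \<P>" and H: "pair_graph H"
  obtains f where "matching H f H f" "\<And>P u. P \<in> \<P> \<Longrightarrow> u \<in> P \<Longrightarrow> f u = P"
proof -
  have part: "partition_on (pverts H) \<P>" using assms unfolding equitable_def by blast
  define f where "f u = (THE P. P \<in> \<P> \<and> u \<in> P)" for u
  have f: "f u = P" if "P \<in> \<P>" "u \<in> P" for P u
    unfolding f_def using that part
    by (intro the_equality) (auto simp: partition_on_def disjoint_def)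
  have cell: "f u \<in> \<P> \<and> u \<in> f u" if "u \<in> pverts H" for u
    using that part f unfolding partition_on_def by (metis UnionE)
  have "card {w \<in> nbrs H u. f w = Q} = card {w \<in> nbrs H v. f w = Q}"
    if uv: "u \<in> pverts H" "v \<in> pverts H" "f u = f v" for u v Q
  proof (cases "Q \<in> \<P>")
    case True
    then have "{w \<in> nbrs H u. f w = Q} = {w \<in> Q. (u, w) \<in> parcs H}" for u
      using f cell pair_graphD(4)[OF H] by blast
    then show ?thesis using assms(1) True cell[OF uv(1)] cell[OF uv(2)] uv(3)
      unfolding equitable_def by (metis (no_types, lifting))
  next
    case False
    then have "{w \<in> nbrs H u. f w = Q} = {}" for u
      using cell pair_graphD(4)[OF H] by blast
    then show ?thesis by (simp only:)
  qed
  then have "matching H f H f" unfolding matching_def by blast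
  then show thesis using that f by blast
qed

text \<open>Colouring by the cells of any equitable partition is matching, so all refinement colours
  agree within a cell. By \<open>sep\<close>, \<open>g\<close> is then constant on the cell, which
  therefore lies in a fibre of \<open>g\<close>.\<close>

lemma coarsest_equitable_fibres:
  assumes H: "pair_graph H" and m: "matching H g H g"
    and sep: "\<And>u v. u \<in> pverts H \<Longrightarrow> v \<in> pverts H \<Longrightarrow>
       (\<And>k. refinement H k u = refinement H k v) \<Longrightarrow> g u = g v"
  shows "coarsest_equitable H ((\<lambda>c. {v \<in> pverts H. g v = c}) ` g ` pverts H)" (is "coarsest_equitable H ?P")
proof -
  have part: "partition_on (pverts H) ?P"
    by (auto simp: partition_on_def disjoint_def)
  have "{w \<in> {v \<in> pverts H. g v = c}. (u, w) \<in> parcs H} = {w \<in> nbrs H u. g w = c}" for u c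
    using pair_graphD(4)[OF H] by blast
  then have eq: "equitable H ?P"
    using part m unfolding equitable_def matching_def by auto
  have "refines (pverts H) \<P> ?P" if eqP: "equitable H \<P>" for \<P>
  proof -
    obtain f where f: "matching H f H f" "\<And>P u. P \<in> \<P> \<Longrightarrow> u \<in> P \<Longrightarrow> f u = P"
      using cell_colouring[OF eqP H] by blast
    have part': "partition_on (pverts H) \<P>" using eqP unfolding equitable_def by blast
    have "\<exists>Y\<in>?P. p \<subseteq> Y" if "p \<in> \<P>" for p
    proof -
      have sub: "p \<subseteq> pverts H" "p \<noteq> {}" using part' that by (auto simp: partition_on_def)
      then obtain u where u: "u \<in> p" by auto
      have "g v = g u" if "v \<in> p" for v
      proof (rule sep)
        show uv: "v \<in> pverts H" "u \<in> pverts H" using \<open>v \<in> p\<close> u sub by blast+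
        show "refinement H k v = refinement H k u" for k
          by (rule refinement_matching[OF H H f(1) uv])
            (simp only: f(2)[OF \<open>p \<in> \<P>\<close> \<open>v \<in> p\<close>] f(2)[OF \<open>p \<in> \<P>\<close> u])
      qed
      then show ?thesis using u sub by (auto intro!: bexI[of _ u])
    qed
    then show ?thesis using part part' by (auto simp: refines_def)
  qed
  then show ?thesis using eq by (simp add: coarsest_equitable_def)
qed

section \<open>Connection sets\<close>

text \<open>Each residue modulo \<open>g\<close> is attained \<open>q\<close> times on
  \<open>{..<g * q}\<close>. The bijection sends \<open>b\<close> to its quotient and the residue of
  \<open>a - b\<close>; conversely, \<open>(a - s) mod g\<close> recovers the remainder of
  \<open>b\<close>.\<close>

lemma card_mod_shift:
  fixes a :: int and g q :: nat and S :: "int set"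
  assumes "g > 0" and S: "S \<subseteq> {0..<int g}"
  shows "card {b \<in> {..<g * q}. (a - int b) mod int g \<in> S} = q * card S"
proof -
  have red: "(a - int b) mod int g = (a - int (b mod g)) mod int g" for b
    by (simp add: of_nat_mod mod_diff_right_eq)
  have "bij_betw (\<lambda>b. (b div g, (a - int b) mod int g))
      {b \<in> {..<g * q}. (a - int b) mod int g \<in> S} ({..<q} \<times> S)"
  proof (rule bij_betwI[where g = "\<lambda>(k, s). k * g + nat ((a - s) mod int g)"])
    show "(\<lambda>b. (b div g, (a - int b) mod int g))
        \<in> {b \<in> {..<g * q}. (a - int b) mod int g \<in> S} \<rightarrow> {..<q} \<times> S"
      using \<open>g > 0\<close> by (auto simp: less_mult_imp_div_less mult.commute)
  next
    have "(case p of (k, s) \<Rightarrow> k * g + nat ((a - s) mod int g))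
        \<in> {b \<in> {..<g * q}. (a - int b) mod int g \<in> S} \<and>
       (\<lambda>b. (b div g, (a - int b) mod int g)) (case p of (k, s) \<Rightarrow> k * g + nat ((a - s) mod int g)) = p"
      if "p \<in> {..<q} \<times> S" for p
    proof -
      obtain k s where p: "p = (k, s)" "k < q" "s \<in> S" using \<open>p \<in> {..<q} \<times> S\<close> by auto
      define r where "r = nat ((a - s) mod int g)"
      have s: "0 \<le> s" "s < int g" using p S by auto
      have r: "int r = (a - s) mod int g" "r < g"
        using \<open>g > 0\<close> by (simp_all add: r_def nat_less_iff)
      have "(a - int r) mod int g = s mod int g"
        by (simp add: r mod_diff_right_eq)
      moreover have "(k * g + r) mod g = r" using r(2) by simp
      ultimately have "(a - int (k * g + r)) mod int g = s"
        using red[of "k * g + r"] s by (simp only: mod_pos_pos_trivial)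
      moreover have "k * g + r < g * q"
      proof -
        have "k * g + r < Suc k * g" using r by simp
        also have "\<dots> \<le> q * g" using p by (intro mult_le_mono1) simp
        finally show ?thesis by (simp add: mult.commute)
      qed
      moreover have "(k * g + r) div g = k" using r(2) by simp
      ultimately show ?thesis using p by (simp add: r_def[symmetric])
    qed
    then show "(\<lambda>(k, s). k * g + nat ((a - s) mod int g))
        \<in> {..<q} \<times> S \<rightarrow> {b \<in> {..<g * q}. (a - int b) mod int g \<in> S}"
      "\<And>p. p \<in> {..<q} \<times> S \<Longrightarrow> (\<lambda>b. (b div g, (a - int b) mod int g))
         ((\<lambda>(k, s). k * g + nat ((a - s) mod int g)) p) = p"
      by blast+
  next
    fix b assume "b \<in> {b \<in> {..<g * q}. (a - int b) mod int g \<in> S}"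
    have "(a - (a - int b) mod int g) mod int g = int (b mod g)"
      by (simp add: mod_diff_right_eq of_nat_mod)
    then show "(\<lambda>(k, s). k * g + nat ((a - s) mod int g)) (b div g, (a - int b) mod int g) = b"
      by simp
  qed
  from bij_betw_same_card[OF this] show ?thesis by (simp only: card_cartesian_product card_lessThan)
qed

text \<open>Here \<open>r\<close> will be the number of residues in a connection set. It exists
  because \<open>n'\<close> divides both \<open>n * d\<close> and \<open>n' * d\<close>, hence also
  their greatest common divisor \<open>d * gcd n n'\<close>.\<close>

lemma ex_card_mult_eq_gcd:
  fixes n n' d d' :: nat
  assumes "n * d = n' * d'" "n' > 0" "d \<le> n'"
  obtains r where "r \<le> gcd n n'" "r * n' = d * gcd n n'"
proof -
  have "n' dvd gcd (n * d) (n' * d)" using assms(1) by simp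
  then have "n' dvd d * gcd n n'" by (simp add: gcd_mult_distrib_nat mult.commute)
  then obtain r where r: "d * gcd n n' = n' * r" by (elim dvdE)
  have "n' * r \<le> n' * gcd n n'" using r[symmetric] assms(3) by simp
  then have "r \<le> gcd n n'" using assms(2) by simp
  then show thesis using that r by (simp add: mult.commute)
qed

text \<open>Take \<open>1, ..., d div 2\<close> together with their negatives modulo
  \<open>n\<close>. If \<open>d\<close> is odd, the parity assumption makes \<open>n\<close> even,
  and \<open>n div 2\<close>, its own negative, supplies the missing element.\<close>

lemma ex_symmetric_connection_set:
  fixes n d :: nat
  assumes "d < n" and "even (n * d)"
  obtains T where "T \<subseteq> {0<..<int n}" "card T = d" "\<And>s. s \<in> T \<Longrightarrow> int n - s \<in> T"
proof -
  define h where "h = d div 2"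
  define A B where "A = {0<..int h}" and "B = {int n - int h..<int n}"
  have h: "2 * h \<le> d" unfolding h_def by simp
  have AB: "card A = h" "card B = h" "A \<inter> B = {}" "finite A" "finite B"
    using h assms(1) by (auto simp: A_def B_def)
  show thesis
  proof (cases "even d")
    case True
    then have "d = h + h" by (auto simp: h_def)
    then have "card (A \<union> B) = d" using AB by (simp add: card_Un_disjoint)
    then show thesis using h assms(1) by (intro that[of "A \<union> B"]) (auto simp: A_def B_def)
  next
    case False
    then obtain c where n: "n = 2 * c" using assms(2) by (auto elim: evenE)
    have d: "d = Suc (h + h)" using False by (auto simp: h_def elim: oddE)
    \<comment> \<open>From \<open>2 * h + 1 < 2 * c\<close>: the midpoint lies strictly between the
      two blocks \<open>A\<close> and \<open>B\<close>.\<close>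
    then have "h < c" using n assms(1) by simp
    then have "int c \<notin> A \<union> B" by (auto simp: A_def B_def n)
    then have "card (insert (int c) (A \<union> B)) = d" using AB d by (simp add: card_Un_disjoint)
    then show thesis using \<open>h < c\<close> by (intro that[of "insert (int c) (A \<union> B)"]) (auto simp: A_def B_def n)
  qed
qed

text \<open>Above the diagonal the first \<open>r i j\<close> residues are chosen, and below it the
  negatives of the set with exchanged indices. On the diagonal the modulus is \<open>n i\<close>,
  and a symmetric set without 0 is needed.\<close>

lemma ex_connection_sets:
  fixes n :: "nat \<Rightarrow> nat" and d :: "nat \<Rightarrow> nat \<Rightarrow> nat"
  assumes pos: "\<And>i. i < m \<Longrightarrow> n i > 0"
    and sym: "\<And>i j. i < m \<Longrightarrow> j < m \<Longrightarrow> n i * d i j = n j * d j i"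
    and le: "\<And>i j. i < m \<Longrightarrow> j < m \<Longrightarrow> d i j \<le> n j"
    and diag: "\<And>i. i < m \<Longrightarrow> d i i < n i" "\<And>i. i < m \<Longrightarrow> even (n i * d i i)"
  obtains S :: "nat \<Rightarrow> nat \<Rightarrow> int set" where
    "\<And>i j. i < m \<Longrightarrow> j < m \<Longrightarrow> S i j \<subseteq> {0..<int (gcd (n i) (n j))}"
    "\<And>i j. i < m \<Longrightarrow> j < m \<Longrightarrow> card (S i j) * n j = d i j * gcd (n i) (n j)"
    "\<And>i j s. i < m \<Longrightarrow> j < m \<Longrightarrow> s \<in> S i j \<Longrightarrow> (- s) mod int (gcd (n i) (n j)) \<in> S j i"
    "\<And>i. i < m \<Longrightarrow> 0 \<notin> S i i"
proof -
  have "\<exists>r. r \<le> gcd (n i) (n j) \<and> r * n j = d i j * gcd (n i) (n j)" if "i < m" "j < m" for i j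
    using ex_card_mult_eq_gcd[OF sym[OF that] pos[OF that(2)] le[OF that]] by metis
  then obtain r where r: "\<And>i j. i < m \<Longrightarrow> j < m \<Longrightarrow> r i j \<le> gcd (n i) (n j)"
    "\<And>i j. i < m \<Longrightarrow> j < m \<Longrightarrow> r i j * n j = d i j * gcd (n i) (n j)" by metis
  have "\<exists>T. T \<subseteq> {0<..<int (n i)} \<and> card T = d i i \<and> (\<forall>s\<in>T. int (n i) - s \<in> T)" if "i < m" for i
    using ex_symmetric_connection_set[OF diag[OF that]] by metis
  then obtain T where T: "\<And>i. i < m \<Longrightarrow> T i \<subseteq> {0<..<int (n i)}" "\<And>i. i < m \<Longrightarrow> card (T i) = d i i"
    "\<And>i s. i < m \<Longrightarrow> s \<in> T i \<Longrightarrow> int (n i) - s \<in> T i" by metis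
  define N where "N i j s = (- s) mod int (gcd (n i) (n j))" for i j s
  define S where "S i j = (if i < j then {0..<int (r i j)}
    else if j < i then N i j ` {0..<int (r j i)} else T i)" for i j
  \<comment> \<open>Both index orders give the same modulus, so negation is an involution on
    residues.\<close>
  have NN: "N j i (N i j s) = s" if "0 \<le> s" "s < int (gcd (n i) (n j))" for i j s
    using that by (simp add: N_def gcd.commute mod_minus_eq)
  \<comment> \<open>Negating a set keeps its size, so the sizes required for the two index orders
    have to agree; double counting ensures this.\<close>
  have r_sym: "r i j = r j i" if "i < m" "j < m" for i j
  proof -
    have "r i j * (n i * n j) = n i * (r i j * n j)" by simp
    also have "\<dots> = n i * d i j * gcd (n i) (n j)" using r(2)[OF that] by simp
    also have "\<dots> = n j * (d j i * gcd (n j) (n i))" using sym[OF that] by (simp add: gcd.commute)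
    also have "\<dots> = r j i * (n i * n j)" using r(2)[OF that(2,1)] by simp
    finally show ?thesis using pos[OF that(1)] pos[OF that(2)] by simp
  qed
  have card_N: "card (N i j ` {0..<int (r j i)}) = r j i" if "i < m" "j < m" for i j
  proof -
    have "inj_on (N i j) {0..<int (r j i)}"
      using r(1)[OF that] r_sym[OF that] by (intro inj_on_inverseI[where g = "N j i"] NN) auto
    then show ?thesis by (simp add: card_image)
  qed
  show thesis
  proof (rule that[of S])
    fix i j assume ij: "i < m" "j < m"
    have g: "gcd (n i) (n j) > 0" using pos ij by simp
    show "S i j \<subseteq> {0..<int (gcd (n i) (n j))}"
      using r(1)[OF ij] T(1)[OF ij(1)] g by (auto simp: S_def N_def)
    show "card (S i j) * n j = d i j * gcd (n i) (n j)"
      using r(2)[OF ij] T(2)[OF ij(1)] card_N[OF ij] r_sym[OF ij] by (auto simp: S_def)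
    fix s assume s: "s \<in> S i j"
    consider "i < j" | "j < i" | "i = j" by linarith
    then have "N i j s \<in> S j i"
    proof cases
      case 1
      then have "s \<in> {0..<int (r i j)}" using s by (simp add: S_def)
      moreover have "N i j s = N j i s" by (simp add: N_def gcd.commute)
      ultimately show ?thesis using 1 by (simp add: S_def)
    next
      case 2
      then obtain t where t: "t \<in> {0..<int (r j i)}" "s = N i j t" using s by (auto simp: S_def)
      moreover have "N i j s = N j i s" by (simp add: N_def gcd.commute)
      ultimately have "N i j s = t" using NN[of t i j] r(1)[OF ij] r_sym[OF ij] by simp
      then show ?thesis using 2 t by (simp add: S_def)
    next
      case 3
      then have sT: "s \<in> T i" using s by (simp add: S_def)
      then have "0 < s" "s < int (n i)" using T(1)[OF ij(1)] by auto
      then have "(int (n i) - s) mod int (n i) = int (n i) - s" by (intro mod_pos_pos_trivial) auto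
      then have "N i j s = int (n i) - s" using 3 by (simp add: N_def)
      then show ?thesis using 3 T(3)[OF ij(1) sT] by (simp add: S_def)
    qed
    then show "(- s) mod int (gcd (n i) (n j)) \<in> S j i" by (simp add: N_def)
  next
    fix i assume "i < m"
    then show "0 \<notin> S i i" using T(1)[of i] by (auto simp: S_def)
  qed
qed

section \<open>The multi-circulant graph of a family of connection sets\<close>

text \<open>
  The vertex \<open>prod_encode (i, a)\<close> with \<open>a < n i\<close> is the element \<open>a\<close> of a copy of the cyclic group of
  order \<open>n i\<close>. Adjacency only depends on the difference of the positions modulo the greatest common
  divisor of the two orders, hence is invariant under the simultaneous rotation of all copies.
\<close>

abbreviation idx :: "nat \<Rightarrow> nat" where "idx v \<equiv> fst (prod_decode v)"
abbreviation pos :: "nat \<Rightarrow> nat" where "pos v \<equiv> snd (prod_decode v)"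

definition circ_verts :: "nat \<Rightarrow> (nat \<Rightarrow> nat) \<Rightarrow> nat set" where
  "circ_verts m n = {v. idx v < m \<and> pos v < n (idx v)}"

definition circ_rel :: "(nat \<Rightarrow> nat) \<Rightarrow> (nat \<Rightarrow> nat \<Rightarrow> int set) \<Rightarrow> nat \<Rightarrow> nat \<Rightarrow> bool" where
  "circ_rel n S u v \<longleftrightarrow>
     (int (pos u) - int (pos v)) mod int (gcd (n (idx u)) (n (idx v))) \<in> S (idx u) (idx v)"

definition circ_graph :: "nat \<Rightarrow> (nat \<Rightarrow> nat) \<Rightarrow> (nat \<Rightarrow> nat \<Rightarrow> int set) \<Rightarrow> nat pair_pre_digraph" where
  "circ_graph m n S = \<lparr>pverts = circ_verts m n,
     parcs = {(u, v). u \<in> circ_verts m n \<and> v \<in> circ_verts m n \<and> circ_rel n S u v}\<rparr>"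

lemma circ_cell:
  "i < m \<Longrightarrow> {v \<in> circ_verts m n. idx v = i} = (\<lambda>a. prod_encode (i, a)) ` {..<n i}"
proof (intro equalityI subsetI)
  fix v assume "v \<in> {v \<in> circ_verts m n. idx v = i}"
  then have "pos v < n i" "v = prod_encode (i, pos v)"
    by (auto simp: circ_verts_def prod.collapse)
  then show "v \<in> (\<lambda>a. prod_encode (i, a)) ` {..<n i}" by blast
qed (auto simp: circ_verts_def)

lemma inj_prod_encode_snd: "inj_on (\<lambda>a. prod_encode (i, a)) A"
  by (auto simp: inj_on_def)

lemma card_circ_cell: "i < m \<Longrightarrow> card {v \<in> circ_verts m n. idx v = i} = n i"
  by (simp add: circ_cell card_image inj_prod_encode_snd)

lemma finite_circ_verts: "finite (circ_verts m n)"
proof -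
  have "prod_decode ` circ_verts m n \<subseteq> (SIGMA i:{..<m}. {..<n i})"
    by (auto simp: circ_verts_def) (metis fst_conv, metis fst_conv snd_conv)
  then show ?thesis by (rule inj_on_finite[OF inj_prod_decode]) simp
qed

text \<open>Exchanging the endpoints negates the difference of positions, which \<open>sym\<close>
  permits; a loop would have difference 0, which \<open>irr\<close> excludes.\<close>

lemma pair_graph_circ_graph:
  assumes sym: "\<And>i j s. i < m \<Longrightarrow> j < m \<Longrightarrow> s \<in> S i j \<Longrightarrow> (- s) mod int (gcd (n i) (n j)) \<in> S j i"
    and irr: "\<And>i. i < m \<Longrightarrow> 0 \<notin> S i i"
  shows "pair_graph (circ_graph m n S)"
proof
  have fin: "finite (circ_verts m n)" by (rule finite_circ_verts)
  then show "finite (pverts (circ_graph m n S))" by (simp add: circ_graph_def)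
  show "finite (parcs (circ_graph m n S))"
    by (rule finite_subset[of _ "circ_verts m n \<times> circ_verts m n"]) (auto simp: circ_graph_def fin)
  have "circ_rel n S v u" if "u \<in> circ_verts m n" "v \<in> circ_verts m n" "circ_rel n S u v" for u v
  proof -
    have "(- ((int (pos u) - int (pos v)) mod int (gcd (n (idx u)) (n (idx v)))))
        mod int (gcd (n (idx u)) (n (idx v))) \<in> S (idx v) (idx u)"
      using that by (intro sym) (auto simp: circ_rel_def circ_verts_def)
    then show ?thesis by (simp add: circ_rel_def mod_minus_eq gcd.commute)
  qed
  then show "symmetric (with_proj (circ_graph m n S))"
    by (auto simp: symmetric_def sym_def circ_graph_def arcs_ends_def arc_to_ends_def)
  show "fst e \<noteq> snd e" if "e \<in> parcs (circ_graph m n S)" for e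
    using that irr by (auto simp: circ_graph_def circ_rel_def circ_verts_def)
qed (auto simp: circ_graph_def)

text \<open>With \<open>g\<close> the gcd and \<open>n j = g * q\<close>, each residue in
  \<open>S i j\<close> is met by \<open>q\<close> vertices of cell \<open>j\<close>. The hypothesis
  \<open>card\<close> turns \<open>q * card (S i j)\<close> into \<open>d\<close> after cancelling
  \<open>g\<close>.\<close>

lemma card_nbrs_circ_graph:
  assumes u: "u \<in> circ_verts m n" and "idx u = i" "j < m" "n j > 0"
    and S: "S i j \<subseteq> {0..<int (gcd (n i) (n j))}"
    and card: "card (S i j) * n j = d * gcd (n i) (n j)"
  shows "card {w \<in> nbrs (circ_graph m n S) u. idx w = j} = d"
proof -
  define g where "g = gcd (n i) (n j)"
  have "g > 0" using assms(4) by (simp add: g_def)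
  obtain q where q: "n j = g * q" using gcd_dvd2 unfolding g_def dvd_def by blast
  have "{w \<in> nbrs (circ_graph m n S) u. idx w = j} =
      (\<lambda>b. prod_encode (j, b)) ` {b \<in> {..<g * q}. (int (pos u) - int b) mod int g \<in> S i j}"
    (is "?L = ?R")
  proof -
    have "?L = {w \<in> {v \<in> circ_verts m n. idx v = j}. (int (pos u) - int (pos w)) mod int g \<in> S i j}"
      using u assms(2) by (auto simp: circ_graph_def circ_rel_def g_def)
    also have "\<dots> = ?R" unfolding circ_cell[OF \<open>j < m\<close>] q[symmetric] by auto
    finally show ?thesis .
  qed
  then have "card {w \<in> nbrs (circ_graph m n S) u. idx w = j} = q * card (S i j)"
    using card_mod_shift[OF \<open>g > 0\<close>, of "S i j"] S
    by (simp add: card_image inj_prod_encode_snd g_def)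
  moreover have "g * (q * card (S i j)) = g * d"
  proof -
    have "card (S i j) * n j = d * g" using card by (simp only: g_def)
    then show ?thesis unfolding q by (simp only: ac_simps)
  qed
  ultimately show ?thesis using \<open>g > 0\<close> by simp
qed

section \<open>The simultaneous rotation and its cycles\<close>

text \<open>Numbers that are not vertices are fixed, as \<open>permutes\<close> demands.\<close>

definition rotation :: "nat \<Rightarrow> (nat \<Rightarrow> nat) \<Rightarrow> nat \<Rightarrow> nat" where
  "rotation m n v =
     (if v \<in> circ_verts m n then prod_encode (idx v, Suc (pos v) mod n (idx v)) else v)"

lemma rotation_in: "v \<in> circ_verts m n \<Longrightarrow> rotation m n v \<in> circ_verts m n"
  by (auto simp: rotation_def circ_verts_def)

lemma funpow_rotation:
  assumes "i < m" "n i > 0"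
  shows "(rotation m n ^^ k) (prod_encode (i, 0)) = prod_encode (i, k mod n i)"
  using assms by (induction k) (auto simp: rotation_def circ_verts_def mod_Suc_eq)

text \<open>The orbit of position 0 closes after \<open>n i\<close> steps, and the iterates before
  that run through all positions of the cell.\<close>

lemma cyclic_on_rotation:
  assumes "i < m" "n i > 0"
  shows "cyclic_on (rotation m n) {v \<in> circ_verts m n. idx v = i}"
proof (rule cyclic_on_singleI)
  show "prod_encode (i, 0) \<in> {v \<in> circ_verts m n. idx v = i}"
    using assms by (simp add: circ_verts_def)
  have "orbit (rotation m n) (prod_encode (i, 0)) = {prod_encode (i, k mod n i) |k. k < n i}"
    using orbit_altdef_bounded[of "n i" "rotation m n" "prod_encode (i, 0)"] assms
    by (simp add: funpow_rotation)
  also have "\<dots> = {prod_encode (i, k) |k. k < n i}"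
    by (rule Collect_cong) (metis mod_less)
  finally have "orbit (rotation m n) (prod_encode (i, 0)) = {prod_encode (i, k) |k. k < n i}" .
  then show "{v \<in> circ_verts m n. idx v = i} = orbit (rotation m n) (prod_encode (i, 0))"
    using assms(1) by (auto simp: circ_cell)
qed

text \<open>Every vertex lies on its own cycle and so has a preimage; on a finite set, surjectivity
  gives injectivity. The gcd divides both orders, so wrapping around does not affect residues modulo
  it, and the two increments cancel in the difference.\<close>

lemma graph_automorphism_rotation:
  "graph_automorphism (circ_graph m n S) (rotation m n)"
proof -
  let ?V = "circ_verts m n"
  have "?V \<subseteq> rotation m n ` ?V"
  proof
    fix v assume v: "v \<in> ?V"
    then have c: "cyclic_on (rotation m n) {w \<in> ?V. idx w = idx v}"
      by (intro cyclic_on_rotation) (auto simp: circ_verts_def)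
    then have "v \<in> orbit (rotation m n) v" using v unfolding cyclic_on_alldef by blast
    then obtain w where "w \<in> orbit (rotation m n) v \<union> {v}" "v = rotation m n w"
      by (cases rule: orbit.cases) auto
    moreover have "orbit (rotation m n) v \<subseteq> ?V"
      using c v unfolding cyclic_on_alldef by blast
    ultimately show "v \<in> rotation m n ` ?V" using v by blast
  qed
  then have "rotation m n ` ?V = ?V" using rotation_in by blast
  then have perm: "rotation m n permutes ?V"
    by (intro inj_imp_permutes) (auto simp: finite_circ_verts finite_surj_inj rotation_in
      rotation_def[of m n v for v])
  have "circ_rel n S (rotation m n u) (rotation m n v) \<longleftrightarrow> circ_rel n S u v"
    if "u \<in> ?V" "v \<in> ?V" for u v
  proof -
    define g where "g = int (gcd (n (idx u)) (n (idx v)))"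
    have "int (a mod k) mod g = int a mod g" if "g dvd int k" for a k
      using that by (simp add: of_nat_mod mod_mod_cancel)
    moreover have "g dvd int (n (idx u))" "g dvd int (n (idx v))" by (simp_all add: g_def)
    ultimately have "(int (Suc (pos u) mod n (idx u)) - int (Suc (pos v) mod n (idx v))) mod g
        = (int (Suc (pos u)) - int (Suc (pos v))) mod g"
      by (intro mod_diff_cong)
    then show ?thesis using that by (simp add: circ_rel_def rotation_def g_def)
  qed
  then show ?thesis
    using perm by (simp add: graph_automorphism_def circ_graph_def rotation_in)
qed

section \<open>Transfer of the parameters of \<open>G\<close> to a multi-circulant graph\<close>

theorem theorem3p3:
  fixes G :: "'a pair_pre_digraph"
  assumes "pair_graph G"
  shows "\<exists>H :: nat pair_pre_digraph. pair_graph H \<and> c2_equivalent G H \<and>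
           (\<exists>\<P>. coarsest_equitable H \<P> \<and> multi_circulant H \<P>)"
proof -
  note G = assms
  obtain f :: "'a \<Rightarrow> nat" and m where f: "f ` pverts G = {..<m}" "matching G f G f"
    "\<And>u v. u \<in> pverts G \<Longrightarrow> v \<in> pverts G \<Longrightarrow> (\<And>k. refinement G k u = refinement G k v) \<Longrightarrow> f u = f v"
    using stable_colouring[OF G] by blast
  have f_less: "f u < m" if "u \<in> pverts G" for u using f(1) that by blast
  have "\<exists>u\<in>pverts G. f u = i" if "i < m" for i
  proof -
    have "i \<in> f ` pverts G" using that by (simp only: f(1) lessThan_iff)
    then show ?thesis by blast
  qed
  then obtain rep where rep: "\<And>i. i < m \<Longrightarrow> rep i \<in> pverts G" "\<And>i. i < m \<Longrightarrow> f (rep i) = i" by metis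
  define n where "n i = card {u \<in> pverts G. f u = i}" for i
  define d where "d i j = card {w \<in> nbrs G (rep i). f w = j}" for i j
  \<comment> \<open>Since \<open>f\<close> matches itself, the choice of representatives does not
    affect \<open>d\<close>.\<close>
  have deg: "card {w \<in> nbrs G u. f w = j} = d (f u) j" if "u \<in> pverts G" for u j
    unfolding d_def
    by (rule f(2)[unfolded matching_def, rule_format]) (simp_all only: that rep[OF f_less[OF that]])
  have fin: "finite {u \<in> pverts G. f u = i}" for i using pair_graphD(1)[OF G] by simp
  have n_pos: "n i > 0" if "i < m" for i
  proof -
    have "{u \<in> pverts G. f u = i} \<noteq> {}" using rep that by blast
    then show ?thesis using fin[of i] unfolding n_def by (simp only: card_gt_0_iff simp_thms)
  qed
  \<comment> \<open>Counting these arcs from either end gives the symmetry of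
    \<open>n i * d i j\<close>; for \<open>i = j\<close> they form a symmetric irreflexive relation,
    so their number is even.\<close>
  define E where "E i j = {(u, w). (u, w) \<in> parcs G \<and> f u = i \<and> f w = j}" for i j
  have card_E: "card (E i j) = n i * d i j" for i j
  proof -
    have "E i j = Sigma {u \<in> pverts G. f u = i} (\<lambda>u. {w \<in> nbrs G u. f w = j})"
      using pair_graphD(3)[OF G] by (auto simp: E_def)
    moreover have "card \<dots> = (\<Sum>u\<in>{u \<in> pverts G. f u = i}. card {w \<in> nbrs G u. f w = j})"
      using fin pair_graphD(7)[OF G] by (intro card_SigmaI) auto
    moreover have "\<dots> = (\<Sum>u\<in>{u \<in> pverts G. f u = i}. d i j)"
      using deg by (intro sum.cong) auto
    ultimately show ?thesis by (simp add: n_def)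
  qed
  have sym: "n i * d i j = n j * d j i" for i j
  proof -
    have "E j i = prod.swap ` E i j"
      using pair_graphD(5)[OF G] by (auto simp: E_def image_iff)
    then have "card (E j i) = card (E i j)" by (simp add: card_image)
    then show ?thesis by (simp only: card_E)
  qed
  have "even (card (E i i))" for i
  proof (rule even_card_sym_irrefl)
    show "finite (E i i)"
      by (rule finite_subset[OF _ pair_graphD(2)[OF G]]) (auto simp: E_def)
  qed (use pair_graphD(5,6)[OF G] in \<open>auto simp: E_def sym_def irrefl_def\<close>)
  then have even: "even (n i * d i i)" for i by (simp only: card_E)
  have le: "d i j \<le> n j" for i j
    unfolding d_def n_def using pair_graphD(4)[OF G] by (intro card_mono fin) blast
  have less: "d i i < n i" if "i < m" for i
    unfolding d_def n_def
  proof (rule psubset_card_mono[OF fin])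
    \<comment> \<open>The representative belongs to its class but is not its own neighbour, which
      makes the inequality strict.\<close>
    have "rep i \<in> {u \<in> pverts G. f u = i} - {w \<in> nbrs G (rep i). f w = i}"
      using rep[OF that] pair_graphD(6)[OF G] by blast
    then show "{w \<in> nbrs G (rep i). f w = i} \<subset> {u \<in> pverts G. f u = i}"
      using pair_graphD(4)[OF G] by blast
  qed
  obtain S :: "nat \<Rightarrow> nat \<Rightarrow> int set" where S:
    "\<And>i j. i < m \<Longrightarrow> j < m \<Longrightarrow> S i j \<subseteq> {0..<int (gcd (n i) (n j))}"
    "\<And>i j. i < m \<Longrightarrow> j < m \<Longrightarrow> card (S i j) * n j = d i j * gcd (n i) (n j)"
    "\<And>i j s. i < m \<Longrightarrow> j < m \<Longrightarrow> s \<in> S i j \<Longrightarrow> (- s) mod int (gcd (n i) (n j)) \<in> S j i"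
    "\<And>i. i < m \<Longrightarrow> 0 \<notin> S i i"
    using ex_connection_sets[of m n d, OF n_pos sym le less even] by blast
  define H where "H = circ_graph m n S"
  have H: "pair_graph H" unfolding H_def by (rule pair_graph_circ_graph[OF S(3,4)])
  have VH: "pverts H = circ_verts m n" by (simp add: H_def circ_graph_def)
  have idx_less: "idx v < m" if "v \<in> pverts H" for v using that by (simp add: VH circ_verts_def)
  have degH: "card {w \<in> nbrs H v. idx w = j} = d (idx v) j" if v: "v \<in> pverts H" for v j
  proof (cases "j < m")
    case True
    show ?thesis unfolding H_def
    proof (rule card_nbrs_circ_graph)
      show "v \<in> circ_verts m n" using v by (simp only: VH)
    qed (fact refl, fact True, fact n_pos[OF True], fact S(1)[OF idx_less[OF v] True],
        fact S(2)[OF idx_less[OF v] True])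
  next
    case False
    \<comment> \<open>Matching quantifies over all colours; those from \<open>m\<close> on occur in
      neither graph, so both counts are 0.\<close>
    have "{w \<in> nbrs H v. idx w = j} = {}"
      using False idx_less pair_graphD(4)[OF H] by blast
    moreover have "{w \<in> nbrs G (rep (idx v)). f w = j} = {}"
      using False f_less pair_graphD(4)[OF G] by blast
    ultimately show ?thesis unfolding d_def by (simp only: card.empty)
  qed
  have GH: "matching G f H idx" unfolding matching_def using deg degH by simp
  have HH: "matching H idx H idx" unfolding matching_def using degH by simp
  have sizes: "card {u \<in> pverts G. f u = c} = card {v \<in> pverts H. idx v = c}" for c
  proof (cases "c < m")
    case True
    then show ?thesis by (simp only: VH card_circ_cell n_def)
  next
    case False
    then have "{u \<in> pverts G. f u = c} = {}" "{v \<in> pverts H. idx v = c} = {}"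
      using f_less idx_less by blast+
    then show ?thesis by (simp only: card.empty)
  qed
  have c2: "c2_equivalent G H" by (rule c2_equivalent_matching[OF G H GH sizes])
  let ?P = "(\<lambda>c. {v \<in> pverts H. idx v = c}) ` idx ` pverts H"
  have coarsest: "coarsest_equitable H ?P"
  proof (rule coarsest_equitable_fibres[OF H HH])
    fix u v assume uv: "u \<in> pverts H" "v \<in> pverts H" "\<And>k. refinement H k u = refinement H k v"
    \<comment> \<open>Colours are comparable across graphs, so the separation of classes by
      refinement is carried over from \<open>G\<close> to \<open>H\<close> through
      representatives.\<close>
    have ref: "refinement G k (rep (idx w)) = refinement H k w" if "w \<in> pverts H" for w k
      using rep[OF idx_less[OF that]] that by (intro refinement_matching[OF G H GH])
    have "f (rep (idx u)) = f (rep (idx v))"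
    proof (rule f(3))
      show "rep (idx u) \<in> pverts G" "rep (idx v) \<in> pverts G"
        using rep(1) idx_less uv(1,2) by blast+
      show "refinement G k (rep (idx u)) = refinement G k (rep (idx v))" for k
        by (simp only: ref[OF uv(1)] ref[OF uv(2)] uv(3))
    qed
    then show "idx u = idx v" using rep(2) idx_less uv(1,2) by metis
  qed
  moreover have "multi_circulant H ?P"
    unfolding multi_circulant_def
  proof (intro conjI exI ballI)
    show "partition_on (pverts H) ?P"
      using coarsest unfolding coarsest_equitable_def equitable_def by blast
    show "graph_automorphism H (rotation m n)"
      unfolding H_def by (rule graph_automorphism_rotation)
    fix P assume "P \<in> ?P"
    then obtain v where "v \<in> pverts H" "P = {w \<in> pverts H. idx w = idx v}" by blast
    then show "cyclic_on (rotation m n) P"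
      using cyclic_on_rotation idx_less n_pos by (simp only: VH)
  qed
  ultimately show ?thesis using H c2 by blast
qed

end
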